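(* Unit D-objects are unique up to isomorphisms: if $\mathcal C$ is a semi-cartesian category with dependence (SCCwD) and $1\in\mathscr D_{\mathcal C}(T)$, $1'\in\mathscr D_{\mathcal C}(T')$ are both unit D-objects in $\mathcal C$, then $1\cong1'$ as D-objects.
   Context: A category with dependence (CwD) is a category $\mathcal C$ with: for each object $\Gamma$ a class $\mathscr D_{\mathcal C}(\Gamma)$ of D-objects over $\Gamma$; for each $\Gamma$, $A\in\mathscr D_{\mathcal C}(\Gamma)$ a class $\mathscr D_{\mathcal C}(\Gamma,A)$ of D-morphisms from $\Gamma$ to $A$; for each morphism $\phi:\Delta\to\Gamma$ functions $\_\{\phi\}:\mathscr D(\Gamma)\to\mathscr D(\Delta)$ and $\_\{\phi\}:\mathscr D(\Gamma,A)\to\mathscr D(\Delta,A\{\phi\})$ with $A\{\mathrm{id}\}=A$, $a\{\mathrm{id}\}=a$, $A\{\phi\circ\varphi\}=A\{\phi\}\{\varphi\}$, $a\{\phi\circ\varphi\}=a\{\phi\}\{\varphi\}$. A semi-$\Sigma$-space of $\Gamma$ and $A\in\mathscr D(\Gamma)$ is an object $\Gamma.A$ with $\pi_1:\Gamma.A\to\Gamma$ and $\pi_2\in\mathscr D(\Gamma.A,A\{\pi_1\})$ such that for all $\phi:\Delta\to\Gamma$ and $g\in\mathscr D(\Delta,A\{\phi\})$ there is a unique $\langle\phi,g\rangle:\Delta\to\Gamma.A$ with $\pi_1\circ\langle\phi,g\rangle=\phi$ and $\pi_2\{\langle\phi,g\rangle\}=g$. An SCCwD is a CwD that has a terminal object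 and a semi-$\Sigma$-space of every $\Gamma$ and $A$. The category $\mathcal C_{\mathscr D}$ of D-objects in an SCCwD $\mathcal C$: objects are pairs $(\Gamma,C)$ with $C\in\mathscr D(\Gamma)$; morphisms $(\Delta,D)\to(\Gamma,C)$ are pairs $(\phi,f)$ with $\phi:\Delta\to\Gamma$, $f\in\mathscr D(\Delta.D,C\{\phi\circ\pi_1\})$; composition $(\psi,g)\circ(\phi,f)=(\psi\circ\phi,g\{\langle\phi\circ\pi_1,f\rangle\})$; identities $(\mathrm{id}_\Gamma,\pi_2)$. D-objects $A\in\mathscr D(\Gamma)$ and $B\in\mathscr D(\Delta)$ are isomorphic, $A\cong B$, if $(\Gamma,A)\cong(\Delta,B)$ in $\mathcal C_{\mathscr D}$. A D-object $1\in\mathscr D_{\mathcal C}(T)$ is unit iff $T$ is a terminal object of $\mathcal C$ and for each object $\Gamma$ there is a unique D-morphism in $\mathscr D_{\mathcal C}(\Gamma,1\{!_\Gamma\})$, where $!_\Gamma:\Gamma\to T$ is the unique morphism. *)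

theory Defs
  imports Main
begin

text \<open>
  Categories are given by families of hom-sets that need not be disjoint, so composition
  takes the three objects involved as arguments:
  \<open>cmp C X Y Z g f\<close> is \<open>g \<circ> f\<close> for \<open>f : X \<rightarrow> Y\<close> and \<open>g : Y \<rightarrow> Z\<close>.
\<close>

record ('o, 'm) category =
  obj :: "'o set"
  hom :: "'o \<Rightarrow> 'o \<Rightarrow> 'm set"
  cmp :: "'o \<Rightarrow> 'o \<Rightarrow> 'o \<Rightarrow> 'm \<Rightarrow> 'm \<Rightarrow> 'm"
  idm :: "'o \<Rightarrow> 'm"

locale category =
  fixes C :: "('o, 'm, 'z) category_scheme"
  assumes idm_hom: "X \<in> obj C \<Longrightarrow> idm C X \<in> hom C X X"
    and cmp_hom: "\<lbrakk>X \<in> obj C; Y \<in> obj C; Z \<in> obj C; f \<in> hom C X Y; g \<in> hom C Y Z\<rbrakk>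
      \<Longrightarrow> cmp C X Y Z g f \<in> hom C X Z"
    and cmp_idm: "\<lbrakk>X \<in> obj C; Y \<in> obj C; f \<in> hom C X Y\<rbrakk> \<Longrightarrow> cmp C X X Y f (idm C X) = f"
    and idm_cmp: "\<lbrakk>X \<in> obj C; Y \<in> obj C; f \<in> hom C X Y\<rbrakk> \<Longrightarrow> cmp C X Y Y (idm C Y) f = f"
    and cmp_assoc: "\<lbrakk>W \<in> obj C; X \<in> obj C; Y \<in> obj C; Z \<in> obj C;
        f \<in> hom C W X; g \<in> hom C X Y; h \<in> hom C Y Z\<rbrakk>
      \<Longrightarrow> cmp C W Y Z h (cmp C W X Y g f) = cmp C W X Z (cmp C X Y Z h g) f"

definition terminal :: "('o, 'm, 'z) category_scheme \<Rightarrow> 'o \<Rightarrow> bool" where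
  "terminal C T \<longleftrightarrow> T \<in> obj C \<and> (\<forall>X\<in>obj C. \<exists>!f. f \<in> hom C X T)"

definition bang :: "('o, 'm, 'z) category_scheme \<Rightarrow> 'o \<Rightarrow> 'o \<Rightarrow> 'm" where
  "bang C T X = (THE f. f \<in> hom C X T)"

definition isomorphic :: "('o, 'm, 'z) category_scheme \<Rightarrow> 'o \<Rightarrow> 'o \<Rightarrow> bool" where
  "isomorphic C X Y \<longleftrightarrow> X \<in> obj C \<and> Y \<in> obj C \<and>
    (\<exists>f\<in>hom C X Y. \<exists>g\<in>hom C Y X. cmp C X Y X g f = idm C X \<and> cmp C Y X Y f g = idm C Y)"


text \<open>
  \<open>dobj C \<Gamma>\<close> and \<open>dmor C \<Gamma> A\<close> are the D-objects over \<open>\<Gamma>\<close> and the D-morphisms from \<open>\<Gamma>\<close> to \<open>A\<close>.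
  For \<open>\<phi> : \<Delta> \<rightarrow> \<Gamma>\<close>, \<open>osub C \<Delta> \<Gamma> \<phi> A\<close> is \<open>A{\<phi>}\<close>, and \<open>msub C \<Delta> \<Gamma> \<phi> A a\<close> is \<open>a{\<phi>}\<close> for \<open>a\<close> in
  \<open>dmor C \<Gamma> A\<close>.  The D-object \<open>A\<close> is an argument of \<open>msub\<close> since the sets of D-morphisms
  need not be disjoint.
\<close>

record ('o, 'm, 'd, 'e) cwd = "('o, 'm) category" +
  dobj :: "'o \<Rightarrow> 'd set"
  dmor :: "'o \<Rightarrow> 'd \<Rightarrow> 'e set"
  osub :: "'o \<Rightarrow> 'o \<Rightarrow> 'm \<Rightarrow> 'd \<Rightarrow> 'd"
  msub :: "'o \<Rightarrow> 'o \<Rightarrow> 'm \<Rightarrow> 'd \<Rightarrow> 'e \<Rightarrow> 'e"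

locale cwd = category C
  for C :: "('o, 'm, 'd, 'e, 'z) cwd_scheme" +
  assumes osub_dobj: "\<lbrakk>\<Delta> \<in> obj C; \<Gamma> \<in> obj C; \<phi> \<in> hom C \<Delta> \<Gamma>; A \<in> dobj C \<Gamma>\<rbrakk>
      \<Longrightarrow> osub C \<Delta> \<Gamma> \<phi> A \<in> dobj C \<Delta>"
    and msub_dmor: "\<lbrakk>\<Delta> \<in> obj C; \<Gamma> \<in> obj C; \<phi> \<in> hom C \<Delta> \<Gamma>; A \<in> dobj C \<Gamma>; a \<in> dmor C \<Gamma> A\<rbrakk>
      \<Longrightarrow> msub C \<Delta> \<Gamma> \<phi> A a \<in> dmor C \<Delta> (osub C \<Delta> \<Gamma> \<phi> A)"
    and osub_idm: "\<lbrakk>\<Gamma> \<in> obj C; A \<in> dobj C \<Gamma>\<rbrakk> \<Longrightarrow> osub C \<Gamma> \<Gamma> (idm C \<Gamma>) A = A"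
    and msub_idm: "\<lbrakk>\<Gamma> \<in> obj C; A \<in> dobj C \<Gamma>; a \<in> dmor C \<Gamma> A\<rbrakk>
      \<Longrightarrow> msub C \<Gamma> \<Gamma> (idm C \<Gamma>) A a = a"
    and osub_cmp: "\<lbrakk>\<Theta> \<in> obj C; \<Delta> \<in> obj C; \<Gamma> \<in> obj C; \<phi>' \<in> hom C \<Theta> \<Delta>; \<phi> \<in> hom C \<Delta> \<Gamma>;
        A \<in> dobj C \<Gamma>\<rbrakk>
      \<Longrightarrow> osub C \<Theta> \<Gamma> (cmp C \<Theta> \<Delta> \<Gamma> \<phi> \<phi>') A = osub C \<Theta> \<Delta> \<phi>' (osub C \<Delta> \<Gamma> \<phi> A)"
    and msub_cmp: "\<lbrakk>\<Theta> \<in> obj C; \<Delta> \<in> obj C; \<Gamma> \<in> obj C; \<phi>' \<in> hom C \<Theta> \<Delta>; \<phi> \<in> hom C \<Delta> \<Gamma>;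
        A \<in> dobj C \<Gamma>; a \<in> dmor C \<Gamma> A\<rbrakk>
      \<Longrightarrow> msub C \<Theta> \<Gamma> (cmp C \<Theta> \<Delta> \<Gamma> \<phi> \<phi>') A a
        = msub C \<Theta> \<Delta> \<phi>' (osub C \<Delta> \<Gamma> \<phi> A) (msub C \<Delta> \<Gamma> \<phi> A a)"

definition semi_sigma_space ::
    "('o, 'm, 'd, 'e, 'z) cwd_scheme \<Rightarrow> 'o \<Rightarrow> 'd \<Rightarrow> 'o \<Rightarrow> 'm \<Rightarrow> 'e \<Rightarrow> bool" where
  "semi_sigma_space C \<Gamma> A S p q \<longleftrightarrow>
    S \<in> obj C \<and> p \<in> hom C S \<Gamma> \<and> q \<in> dmor C S (osub C S \<Gamma> p A) \<and>
    (\<forall>\<Delta>\<in>obj C. \<forall>\<phi>\<in>hom C \<Delta> \<Gamma>. \<forall>g\<in>dmor C \<Delta> (osub C \<Delta> \<Gamma> \<phi> A).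
      \<exists>!h. h \<in> hom C \<Delta> S \<and> cmp C \<Delta> S \<Gamma> p h = \<phi> \<and> msub C \<Delta> S h (osub C S \<Gamma> p A) q = g)"


text \<open>
  The category of D-objects depends on the choice of the semi-\<open>\<Sigma>\<close>-spaces, so this choice is
  part of the structure: \<open>sigma C \<Gamma> A\<close> is \<open>\<Gamma>.A\<close>, with projections \<open>proj1 C \<Gamma> A\<close> and \<open>proj2 C \<Gamma> A\<close>.
\<close>

record ('o, 'm, 'd, 'e) sccwd = "('o, 'm, 'd, 'e) cwd" +
  sigma :: "'o \<Rightarrow> 'd \<Rightarrow> 'o"
  proj1 :: "'o \<Rightarrow> 'd \<Rightarrow> 'm"
  proj2 :: "'o \<Rightarrow> 'd \<Rightarrow> 'e"

locale sccwd = cwd C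
  for C :: "('o, 'm, 'd, 'e, 'z) sccwd_scheme" +
  assumes ex_terminal: "\<exists>T. terminal C T"
    and sigma_space: "\<lbrakk>\<Gamma> \<in> obj C; A \<in> dobj C \<Gamma>\<rbrakk>
      \<Longrightarrow> semi_sigma_space C \<Gamma> A (sigma C \<Gamma> A) (proj1 C \<Gamma> A) (proj2 C \<Gamma> A)"

text \<open>\<open>pairing C \<Delta> \<Gamma> A \<phi> g\<close> is \<open>\<langle>\<phi>, g\<rangle> : \<Delta> \<rightarrow> \<Gamma>.A\<close>.\<close>

definition pairing ::
    "('o, 'm, 'd, 'e, 'z) sccwd_scheme \<Rightarrow> 'o \<Rightarrow> 'o \<Rightarrow> 'd \<Rightarrow> 'm \<Rightarrow> 'e \<Rightarrow> 'm" where
  "pairing C \<Delta> \<Gamma> A \<phi> g = (THE h. h \<in> hom C \<Delta> (sigma C \<Gamma> A) \<and>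
    cmp C \<Delta> (sigma C \<Gamma> A) \<Gamma> (proj1 C \<Gamma> A) h = \<phi> \<and>
    msub C \<Delta> (sigma C \<Gamma> A) h (osub C (sigma C \<Gamma> A) \<Gamma> (proj1 C \<Gamma> A) A) (proj2 C \<Gamma> A) = g)"

text \<open>
  For \<open>\<phi> : \<Delta> \<rightarrow> \<Gamma>\<close>, \<open>D\<close> over \<open>\<Delta>\<close> and \<open>A\<close> over \<open>\<Gamma>\<close>, \<open>wk C \<Delta> D \<Gamma> \<phi>\<close> is \<open>\<phi> \<circ> \<pi>\<^sub>1 : \<Delta>.D \<rightarrow> \<Gamma>\<close> and
  \<open>wk_sub C \<Delta> D \<Gamma> \<phi> A\<close> is \<open>A{\<phi> \<circ> \<pi>\<^sub>1}\<close>.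
\<close>

definition wk :: "('o, 'm, 'd, 'e, 'z) sccwd_scheme \<Rightarrow> 'o \<Rightarrow> 'd \<Rightarrow> 'o \<Rightarrow> 'm \<Rightarrow> 'm" where
  "wk C \<Delta> D \<Gamma> \<phi> = cmp C (sigma C \<Delta> D) \<Delta> \<Gamma> \<phi> (proj1 C \<Delta> D)"

definition wk_sub :: "('o, 'm, 'd, 'e, 'z) sccwd_scheme \<Rightarrow> 'o \<Rightarrow> 'd \<Rightarrow> 'o \<Rightarrow> 'm \<Rightarrow> 'd \<Rightarrow> 'd" where
  "wk_sub C \<Delta> D \<Gamma> \<phi> A = osub C (sigma C \<Delta> D) \<Gamma> (wk C \<Delta> D \<Gamma> \<phi>) A"

definition dcat :: "('o, 'm, 'd, 'e, 'z) sccwd_scheme \<Rightarrow> ('o \<times> 'd, 'm \<times> 'e) category" where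
  "dcat C = \<lparr>
    obj = {(\<Gamma>, A). \<Gamma> \<in> obj C \<and> A \<in> dobj C \<Gamma>},
    hom = (\<lambda>(\<Delta>, D) (\<Gamma>, A).
      {(\<phi>, f). \<phi> \<in> hom C \<Delta> \<Gamma> \<and> f \<in> dmor C (sigma C \<Delta> D) (wk_sub C \<Delta> D \<Gamma> \<phi> A)}),
    cmp = (\<lambda>(\<Delta>, D) (\<Gamma>, A) (\<Theta>, B) (\<psi>, g) (\<phi>, f).
      (cmp C \<Delta> \<Gamma> \<Theta> \<psi> \<phi>,
       msub C (sigma C \<Delta> D) (sigma C \<Gamma> A)
         (pairing C (sigma C \<Delta> D) \<Gamma> A (wk C \<Delta> D \<Gamma> \<phi>) f)
         (wk_sub C \<Gamma> A \<Theta> \<psi> B) g)),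
    idm = (\<lambda>(\<Gamma>, A). (idm C \<Gamma>, proj2 C \<Gamma> A))
  \<rparr>"

definition dobj_iso :: "('o, 'm, 'd, 'e, 'z) sccwd_scheme \<Rightarrow> 'o \<Rightarrow> 'd \<Rightarrow> 'o \<Rightarrow> 'd \<Rightarrow> bool" where
  "dobj_iso C \<Gamma> A \<Delta> B \<longleftrightarrow> isomorphic (dcat C) (\<Gamma>, A) (\<Delta>, B)"

definition unit_dobj :: "('o, 'm, 'd, 'e, 'z) cwd_scheme \<Rightarrow> 'o \<Rightarrow> 'd \<Rightarrow> bool" where
  "unit_dobj C T U \<longleftrightarrow> terminal C T \<and> U \<in> dobj C T \<and>
    (\<forall>\<Gamma>\<in>obj C. \<exists>!u. u \<in> dmor C \<Gamma> (osub C \<Gamma> T (bang C T \<Gamma>) U))"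

context sccwd
begin

lemma sigma_obj: "\<lbrakk>\<Gamma> \<in> obj C; A \<in> dobj C \<Gamma>\<rbrakk> \<Longrightarrow> sigma C \<Gamma> A \<in> obj C"
  and proj1_hom: "\<lbrakk>\<Gamma> \<in> obj C; A \<in> dobj C \<Gamma>\<rbrakk> \<Longrightarrow> proj1 C \<Gamma> A \<in> hom C (sigma C \<Gamma> A) \<Gamma>"
  and proj2_dmor: "\<lbrakk>\<Gamma> \<in> obj C; A \<in> dobj C \<Gamma>\<rbrakk>
    \<Longrightarrow> proj2 C \<Gamma> A \<in> dmor C (sigma C \<Gamma> A) (osub C (sigma C \<Gamma> A) \<Gamma> (proj1 C \<Gamma> A) A)"
  using sigma_space unfolding semi_sigma_space_def by blast+

lemma pairing_ex1:
  assumes "\<Delta> \<in> obj C" "\<Gamma> \<in> obj C" "A \<in> dobj C \<Gamma>" "\<phi> \<in> hom C \<Delta> \<Gamma>" "g \<in> dmor C \<Delta> (osub C \<Delta> \<Gamma> \<phi> A)"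
  shows "\<exists>!h. h \<in> hom C \<Delta> (sigma C \<Gamma> A) \<and>
    cmp C \<Delta> (sigma C \<Gamma> A) \<Gamma> (proj1 C \<Gamma> A) h = \<phi> \<and>
    msub C \<Delta> (sigma C \<Gamma> A) h (osub C (sigma C \<Gamma> A) \<Gamma> (proj1 C \<Gamma> A) A) (proj2 C \<Gamma> A) = g"
  using sigma_space[OF assms(2,3)] assms unfolding semi_sigma_space_def by blast

lemma
  assumes "\<Delta> \<in> obj C" "\<Gamma> \<in> obj C" "A \<in> dobj C \<Gamma>" "\<phi> \<in> hom C \<Delta> \<Gamma>" "g \<in> dmor C \<Delta> (osub C \<Delta> \<Gamma> \<phi> A)"
  shows pairing_hom: "pairing C \<Delta> \<Gamma> A \<phi> g \<in> hom C \<Delta> (sigma C \<Gamma> A)"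
    and proj1_pairing: "cmp C \<Delta> (sigma C \<Gamma> A) \<Gamma> (proj1 C \<Gamma> A) (pairing C \<Delta> \<Gamma> A \<phi> g) = \<phi>"
    and proj2_pairing: "msub C \<Delta> (sigma C \<Gamma> A) (pairing C \<Delta> \<Gamma> A \<phi> g)
      (osub C (sigma C \<Gamma> A) \<Gamma> (proj1 C \<Gamma> A) A) (proj2 C \<Gamma> A) = g"
  using theI'[OF pairing_ex1[OF assms]] unfolding pairing_def[symmetric] by blast+

lemma pairing_eqI:
  assumes "\<Delta> \<in> obj C" "\<Gamma> \<in> obj C" "A \<in> dobj C \<Gamma>" "h \<in> hom C \<Delta> (sigma C \<Gamma> A)"
    and "cmp C \<Delta> (sigma C \<Gamma> A) \<Gamma> (proj1 C \<Gamma> A) h = \<phi>"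
    and "msub C \<Delta> (sigma C \<Gamma> A) h (osub C (sigma C \<Gamma> A) \<Gamma> (proj1 C \<Gamma> A) A) (proj2 C \<Gamma> A) = g"
  shows "pairing C \<Delta> \<Gamma> A \<phi> g = h"
proof -
  note S = sigma_obj[OF assms(2,3)] and p = proj1_hom[OF assms(2,3)] and q = proj2_dmor[OF assms(2,3)]
  have "\<phi> \<in> hom C \<Delta> \<Gamma>" using cmp_hom[OF assms(1) S assms(2,4) p] assms(5) by simp
  moreover have "g \<in> dmor C \<Delta> (osub C \<Delta> \<Gamma> \<phi> A)"
    using msub_dmor[OF assms(1) S assms(4) osub_dobj[OF S assms(2) p assms(3)] q]
      osub_cmp[OF assms(1) S assms(2,4) p assms(3)] assms(5,6) by simp
  ultimately show ?thesis
    unfolding pairing_def using pairing_ex1[OF assms(1-3)] assms(4-6)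
    by (intro the1_equality) auto
qed

lemma wk_hom:
  "\<lbrakk>\<Delta> \<in> obj C; D \<in> dobj C \<Delta>; \<Gamma> \<in> obj C; \<phi> \<in> hom C \<Delta> \<Gamma>\<rbrakk>
    \<Longrightarrow> wk C \<Delta> D \<Gamma> \<phi> \<in> hom C (sigma C \<Delta> D) \<Gamma>"
  unfolding wk_def by (intro cmp_hom sigma_obj proj1_hom)

lemma wk_sub_dobj:
  "\<lbrakk>\<Delta> \<in> obj C; D \<in> dobj C \<Delta>; \<Gamma> \<in> obj C; \<phi> \<in> hom C \<Delta> \<Gamma>; A \<in> dobj C \<Gamma>\<rbrakk>
    \<Longrightarrow> wk_sub C \<Delta> D \<Gamma> \<phi> A \<in> dobj C (sigma C \<Delta> D)"
  unfolding wk_sub_def by (intro osub_dobj sigma_obj wk_hom)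

lemma wk_pairing:
  assumes "\<Xi> \<in> obj C" "\<Gamma> \<in> obj C" "A \<in> dobj C \<Gamma>" "\<Theta> \<in> obj C" "\<psi> \<in> hom C \<Gamma> \<Theta>"
    and "\<phi> \<in> hom C \<Xi> \<Gamma>" "f \<in> dmor C \<Xi> (osub C \<Xi> \<Gamma> \<phi> A)"
  shows "cmp C \<Xi> (sigma C \<Gamma> A) \<Theta> (wk C \<Gamma> A \<Theta> \<psi>) (pairing C \<Xi> \<Gamma> A \<phi> f) = cmp C \<Xi> \<Gamma> \<Theta> \<psi> \<phi>"
  unfolding wk_def using assms
  by (metis cmp_assoc pairing_hom proj1_hom proj1_pairing sigma_obj)

lemma wk_cmp:
  "\<lbrakk>\<Delta> \<in> obj C; D \<in> dobj C \<Delta>; \<Gamma> \<in> obj C; \<phi> \<in> hom C \<Delta> \<Gamma>; \<Theta> \<in> obj C; \<psi> \<in> hom C \<Gamma> \<Theta>\<rbrakk>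
    \<Longrightarrow> cmp C (sigma C \<Delta> D) \<Gamma> \<Theta> \<psi> (wk C \<Delta> D \<Gamma> \<phi>) = wk C \<Delta> D \<Theta> (cmp C \<Delta> \<Gamma> \<Theta> \<psi> \<phi>)"
  unfolding wk_def by (intro cmp_assoc sigma_obj proj1_hom)

lemma wk_sub_pairing:
  assumes "\<Delta> \<in> obj C" "D \<in> dobj C \<Delta>" "\<Gamma> \<in> obj C" "\<phi> \<in> hom C \<Delta> \<Gamma>" "\<Theta> \<in> obj C" "\<psi> \<in> hom C \<Gamma> \<Theta>"
    and "A \<in> dobj C \<Gamma>" "B \<in> dobj C \<Theta>" "f \<in> dmor C (sigma C \<Delta> D) (wk_sub C \<Delta> D \<Gamma> \<phi> A)"
  shows "osub C (sigma C \<Delta> D) (sigma C \<Gamma> A) (pairing C (sigma C \<Delta> D) \<Gamma> A (wk C \<Delta> D \<Gamma> \<phi>) f)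
    (wk_sub C \<Gamma> A \<Theta> \<psi> B) = wk_sub C \<Delta> D \<Theta> (cmp C \<Delta> \<Gamma> \<Theta> \<psi> \<phi>) B"
proof -
  let ?S = "sigma C \<Delta> D" and ?R = "sigma C \<Gamma> A"
  let ?h = "pairing C ?S \<Gamma> A (wk C \<Delta> D \<Gamma> \<phi>) f"
  note S = sigma_obj[OF assms(1,2)] and R = sigma_obj[OF assms(3,7)]
  note w = wk_hom[OF assms(1-4)]
  have f: "f \<in> dmor C ?S (osub C ?S \<Gamma> (wk C \<Delta> D \<Gamma> \<phi>) A)"
    using assms(9) by (simp add: wk_sub_def)
  note h = pairing_hom[OF S assms(3,7) w f]
  show ?thesis
    using osub_cmp[OF S R assms(5) h wk_hom[OF assms(3,7,5,6)] assms(8)]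
      wk_pairing[OF S assms(3,7,5,6) w f] wk_cmp[OF assms(1-6)]
    by (simp add: wk_sub_def)
qed

lemma pairing_wk:
  assumes "\<Delta> \<in> obj C" "D \<in> dobj C \<Delta>" "\<Gamma> \<in> obj C" "\<phi> \<in> hom C \<Delta> \<Gamma>" "A \<in> dobj C \<Gamma>"
    and "f \<in> dmor C (sigma C \<Delta> D) (wk_sub C \<Delta> D \<Gamma> \<phi> A)"
  shows "pairing C (sigma C \<Delta> D) \<Gamma> A (wk C \<Delta> D \<Gamma> \<phi>) f \<in> hom C (sigma C \<Delta> D) (sigma C \<Gamma> A)"
  using assms by (intro pairing_hom sigma_obj wk_hom) (simp_all add: wk_sub_def)

theorem category_dcat: "category (dcat C)"
proof (unfold_locales, goal_cases)
  case (1 X)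
  obtain \<Gamma> A where X: "X = (\<Gamma>, A)" "\<Gamma> \<in> obj C" "A \<in> dobj C \<Gamma>"
    using 1 by (cases X) (auto simp: dcat_def)
  then show ?case
    by (simp add: dcat_def wk_sub_def wk_def idm_hom idm_cmp[OF sigma_obj _ proj1_hom] proj2_dmor)
next
  case (2 X Y Z f g)
  obtain \<Delta> D \<Gamma> A \<Theta> B \<phi> a \<psi> b where e: "X = (\<Delta>, D)" "Y = (\<Gamma>, A)" "Z = (\<Theta>, B)" "f = (\<phi>, a)" "g = (\<psi>, b)"
    by (cases X, cases Y, cases Z, cases f, cases g)
  have h: "\<Delta> \<in> obj C" "D \<in> dobj C \<Delta>" "\<Gamma> \<in> obj C" "\<phi> \<in> hom C \<Delta> \<Gamma>" "\<Theta> \<in> obj C" "\<psi> \<in> hom C \<Gamma> \<Theta>"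
    "A \<in> dobj C \<Gamma>" "B \<in> dobj C \<Theta>"
    and a: "a \<in> dmor C (sigma C \<Delta> D) (wk_sub C \<Delta> D \<Gamma> \<phi> A)"
    and b: "b \<in> dmor C (sigma C \<Gamma> A) (wk_sub C \<Gamma> A \<Theta> \<psi> B)"
    using 2 by (auto simp: e dcat_def)
  show ?case
    using msub_dmor[OF sigma_obj[OF h(1,2)] sigma_obj[OF h(3,7)] pairing_wk[OF h(1-4,7) a]
        wk_sub_dobj[OF h(3,7,5,6,8)] b]
    by (simp add: e dcat_def wk_sub_pairing[OF h a] cmp_hom[OF h(1,3,5,4,6)])
next
  case (3 X Y f)
  obtain \<Delta> D \<Gamma> A \<phi> a where e: "X = (\<Delta>, D)" "Y = (\<Gamma>, A)" "f = (\<phi>, a)"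
    by (cases X, cases Y, cases f)
  have h: "\<Delta> \<in> obj C" "D \<in> dobj C \<Delta>" "\<Gamma> \<in> obj C" "\<phi> \<in> hom C \<Delta> \<Gamma>" "A \<in> dobj C \<Gamma>"
    and a: "a \<in> dmor C (sigma C \<Delta> D) (wk_sub C \<Delta> D \<Gamma> \<phi> A)"
    using 3 by (auto simp: e dcat_def)
  note S = sigma_obj[OF h(1,2)] and p = proj1_hom[OF h(1,2)]
  have "pairing C (sigma C \<Delta> D) \<Delta> D (wk C \<Delta> D \<Delta> (idm C \<Delta>)) (proj2 C \<Delta> D) = idm C (sigma C \<Delta> D)"
    by (rule pairing_eqI[OF S h(1,2) idm_hom[OF S]])
      (simp_all add: wk_def cmp_idm[OF S h(1) p] idm_cmp[OF S h(1) p]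
        msub_idm[OF S osub_dobj[OF S h(1) p h(2)] proj2_dmor[OF h(1,2)]])
  then show ?case
    by (simp add: e dcat_def cmp_idm[OF h(1,3,4)] msub_idm[OF S wk_sub_dobj[OF h] a])
next
  case (4 X Y f)
  obtain \<Delta> D \<Gamma> A \<phi> a where e: "X = (\<Delta>, D)" "Y = (\<Gamma>, A)" "f = (\<phi>, a)"
    by (cases X, cases Y, cases f)
  have h: "\<Delta> \<in> obj C" "D \<in> dobj C \<Delta>" "\<Gamma> \<in> obj C" "\<phi> \<in> hom C \<Delta> \<Gamma>" "A \<in> dobj C \<Gamma>"
    and a: "a \<in> dmor C (sigma C \<Delta> D) (wk_sub C \<Delta> D \<Gamma> \<phi> A)"
    using 4 by (auto simp: e dcat_def)
  note S = sigma_obj[OF h(1,2)] and R = sigma_obj[OF h(3,5)]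
  have a': "a \<in> dmor C (sigma C \<Delta> D) (osub C (sigma C \<Delta> D) \<Gamma> (wk C \<Delta> D \<Gamma> \<phi>) A)"
    using a by (simp add: wk_sub_def)
  show ?case
    using proj2_pairing[OF S h(3,5) wk_hom[OF h(1-4)] a']
    by (simp add: e dcat_def idm_cmp[OF h(1,3,4)] wk_sub_def[of C \<Gamma>] wk_def[of C \<Gamma>]
        idm_cmp[OF R h(3) proj1_hom[OF h(3,5)]])
next
  case (5 W X Y Z f g k)
  obtain \<Xi> E \<Delta> D \<Gamma> A \<Theta> B \<phi> a \<psi> b \<chi> c where
    e: "W = (\<Xi>, E)" "X = (\<Delta>, D)" "Y = (\<Gamma>, A)" "Z = (\<Theta>, B)" "f = (\<phi>, a)" "g = (\<psi>, b)" "k = (\<chi>, c)"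
    by (cases W, cases X, cases Y, cases Z, cases f, cases g, cases k)
  have o: "\<Xi> \<in> obj C" "E \<in> dobj C \<Xi>" "\<Delta> \<in> obj C" "D \<in> dobj C \<Delta>" "\<Gamma> \<in> obj C" "A \<in> dobj C \<Gamma>"
    "\<Theta> \<in> obj C" "B \<in> dobj C \<Theta>"
    and m: "\<phi> \<in> hom C \<Xi> \<Delta>" "\<psi> \<in> hom C \<Delta> \<Gamma>" "\<chi> \<in> hom C \<Gamma> \<Theta>"
    and a: "a \<in> dmor C (sigma C \<Xi> E) (wk_sub C \<Xi> E \<Delta> \<phi> D)"
    and b: "b \<in> dmor C (sigma C \<Delta> D) (wk_sub C \<Delta> D \<Gamma> \<psi> A)"
    and c: "c \<in> dmor C (sigma C \<Gamma> A) (wk_sub C \<Gamma> A \<Theta> \<chi> B)"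
    using 5 by (auto simp: e dcat_def)
  let ?P = "sigma C \<Xi> E" and ?Q = "sigma C \<Delta> D" and ?R = "sigma C \<Gamma> A"
  let ?h = "pairing C ?P \<Delta> D (wk C \<Xi> E \<Delta> \<phi>) a"
  let ?h' = "pairing C ?Q \<Gamma> A (wk C \<Delta> D \<Gamma> \<psi>) b"
  note P = sigma_obj[OF o(1,2)] and Q = sigma_obj[OF o(3,4)] and R = sigma_obj[OF o(5,6)]
  note h = pairing_wk[OF o(1,2,3) m(1) o(4) a] and h' = pairing_wk[OF o(3,4,5) m(2) o(6) b]
  note p = proj1_hom[OF o(5,6)]
  have a': "a \<in> dmor C ?P (osub C ?P \<Delta> (wk C \<Xi> E \<Delta> \<phi>) D)"
    and b': "b \<in> dmor C ?Q (osub C ?Q \<Gamma> (wk C \<Delta> D \<Gamma> \<psi>) A)"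
    using a b by (simp_all add: wk_sub_def)
  have hh: "cmp C ?P ?Q ?R ?h' ?h \<in> hom C ?P ?R"
    by (rule cmp_hom[OF P Q R h h'])
  have 1: "cmp C ?P ?R \<Gamma> (proj1 C \<Gamma> A) (cmp C ?P ?Q ?R ?h' ?h)
      = wk C \<Xi> E \<Gamma> (cmp C \<Xi> \<Delta> \<Gamma> \<psi> \<phi>)"
    using cmp_assoc[OF P Q R o(5) h h' p]
      proj1_pairing[OF Q o(5,6) wk_hom[OF o(3,4,5) m(2)] b']
      wk_pairing[OF P o(3,4,5) m(2) wk_hom[OF o(1,2,3) m(1)] a']
      wk_cmp[OF o(1,2,3) m(1) o(5) m(2)]
    by simp
  have 2: "msub C ?P ?R (cmp C ?P ?Q ?R ?h' ?h) (osub C ?R \<Gamma> (proj1 C \<Gamma> A) A) (proj2 C \<Gamma> A)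
      = msub C ?P ?Q ?h (wk_sub C \<Delta> D \<Gamma> \<psi> A) b"
    using msub_cmp[OF P Q R h h' osub_dobj[OF R o(5) p o(6)] proj2_dmor[OF o(5,6)]]
      osub_cmp[OF Q R o(5) h' p o(6)]
      proj1_pairing[OF Q o(5,6) wk_hom[OF o(3,4,5) m(2)] b']
      proj2_pairing[OF Q o(5,6) wk_hom[OF o(3,4,5) m(2)] b']
    by (simp add: wk_sub_def)
  have 3: "pairing C ?P \<Gamma> A (wk C \<Xi> E \<Gamma> (cmp C \<Xi> \<Delta> \<Gamma> \<psi> \<phi>))
      (msub C ?P ?Q ?h (wk_sub C \<Delta> D \<Gamma> \<psi> A) b) = cmp C ?P ?Q ?R ?h' ?h"
    by (rule pairing_eqI[OF P o(5,6) hh 1 2])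
  show ?case
    using msub_cmp[OF P Q R h h' wk_sub_dobj[OF o(5,6,7) m(3) o(8)] c]
      wk_sub_pairing[OF o(3,4,5) m(2) o(7) m(3) o(6,8) b]
      cmp_assoc[OF o(1,3,5,7) m]
    by (simp add: e dcat_def 3)
qed

end

end

theory Submission
  imports Defs
begin

text \<open>
  A unit D-object over \<open>T\<close> is a terminal object of the category of D-objects: a morphism
  \<open>(\<Delta>, D) \<rightarrow> (T, U)\<close> consists of the unique \<open>\<Delta> \<rightarrow> T\<close> and a D-morphism from \<open>\<Delta>.D\<close> to
  \<open>U\<close> substituted along the unique \<open>\<Delta>.D \<rightarrow> T\<close>.  Terminal objects are isomorphic.
\<close>

lemma bang_eqI:
  assumes "terminal C T" "X \<in> obj C" "f \<in> hom C X T"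
  shows "bang C T X = f"
  using assms unfolding terminal_def bang_def by (blast intro: the1_equality)

lemma (in category) terminal_isomorphic:
  assumes "terminal C S" "terminal C T"
  shows "isomorphic C S T"
proof -
  have S: "S \<in> obj C" and T: "T \<in> obj C"
    using assms by (auto simp: terminal_def)
  obtain f g where f: "f \<in> hom C S T" and g: "g \<in> hom C T S"
    using assms S T unfolding terminal_def by blast
  \<comment> \<open>Each composite and the matching identity are endomorphisms of the same terminal
    object.\<close>
  have "cmp C S T S g f = idm C S" "cmp C T S T f g = idm C T"
    using assms cmp_hom[OF S T S f g] cmp_hom[OF T S T g f] idm_hom[OF S] idm_hom[OF T] S T
    unfolding terminal_def by blast+
  then show ?thesis
    using S T f g unfolding isomorphic_def by blast
qed

lemma (in sccwd) unit_dobj_terminal: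
  assumes "unit_dobj C T U"
  shows "terminal (dcat C) (T, U)"
proof -
  have T: "terminal C T" "T \<in> obj C" and U: "U \<in> dobj C T"
    and u: "\<And>\<Gamma>. \<Gamma> \<in> obj C \<Longrightarrow> \<exists>!u. u \<in> dmor C \<Gamma> (osub C \<Gamma> T (bang C T \<Gamma>) U)"
    using assms by (auto simp: unit_dobj_def terminal_def)
  have "\<exists>!h. h \<in> hom (dcat C) (\<Delta>, D) (T, U)" if D: "\<Delta> \<in> obj C" "D \<in> dobj C \<Delta>" for \<Delta> D
  proof -
    \<comment> \<open>\<open>wk C \<Delta> D T \<phi>\<close> maps into the terminal
      \<open>T\<close>, so the fibre over \<open>\<phi>\<close> does not depend on
      \<open>\<phi>\<close>: the hom-set, a priori a dependent sum, becomes a product.\<close>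
    have "wk_sub C \<Delta> D T \<phi> U = osub C (sigma C \<Delta> D) T (bang C T (sigma C \<Delta> D)) U"
      if "\<phi> \<in> hom C \<Delta> T" for \<phi>
      using bang_eqI[OF T(1) sigma_obj[OF D] wk_hom[OF D T(2) that]] by (simp add: wk_sub_def)
    then have "hom (dcat C) (\<Delta>, D) (T, U) =
        hom C \<Delta> T \<times> dmor C (sigma C \<Delta> D) (osub C (sigma C \<Delta> D) T (bang C T (sigma C \<Delta> D)) U)"
      by (auto simp: dcat_def)
    moreover have "\<exists>!\<phi>. \<phi> \<in> hom C \<Delta> T"
      using T(1) D(1) by (simp add: terminal_def)
    \<comment> \<open>Both factors are singletons; the unit property is applied at
      \<open>sigma C \<Delta> D\<close>, not at \<open>\<Delta>\<close>.\<close>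
    ultimately show ?thesis
      using u[OF sigma_obj[OF D]] by auto
  qed
  then show ?thesis
    using T(2) U by (auto simp: terminal_def dcat_def)
qed

theorem proposition3p3p4:
  fixes C :: "('o, 'm, 'd, 'e, 'z) sccwd_scheme"
    and T T' :: 'o and U U' :: 'd
  assumes "sccwd C"
    and "unit_dobj C T U"
    and "unit_dobj C T' U'"
  shows "dobj_iso C T U T' U'"
  unfolding dobj_iso_def
  using assms by (intro category.terminal_isomorphic sccwd.category_dcat sccwd.unit_dobj_terminal)

end
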